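(* For every uniformity $r\ge 4$, for all sufficiently large $c$ and $t$, \[ R^r_c(BK_t,BK_t,\dots,BK_t) > t^{\,1+\left(\frac{r-3}{r-2}\right)^{r-3}-\left(\frac{r-3}{r-2}\right)^{r-2}}. \]
   Context: For a graph $G=(V,E)$ and an integer $r\ge 2$, $BG$ is the set of $r$-uniform hypergraphs $\mathcal{H}'$ for which there exist an injection $\phi: V\to V(\mathcal{H}')$ and a bijection $\psi: E\to E(\mathcal{H}')$ such that $\{\phi(u),\phi(v)\}\subseteq \psi(uv)$ for every edge $uv\in E$. $K_t$ is the complete graph on $t$ vertices. $R^r_c(BK_t,\dots,BK_t)$ (with $c$ arguments) is the least $N$ such that every coloring of the hyperedges of the complete $r$-uniform hypergraph on $N$ vertices with $c$ colors contains a monochromatic subhypergraph isomorphic to a member of $BK_t$. *)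

theory Defs
  imports Complex_Main "HOL-Library.Ramsey" "HOL-Library.FuncSet"
begin

type_synonym 'a hypergraph = "'a set \<times> 'a set set"

abbreviation verts :: "'a hypergraph \<Rightarrow> 'a set" where
  "verts H \<equiv> fst H"

abbreviation edges :: "'a hypergraph \<Rightarrow> 'a set set" where
  "edges H \<equiv> snd H"

definition uniform :: "nat \<Rightarrow> 'a hypergraph \<Rightarrow> bool" where
  "uniform r H \<longleftrightarrow> edges H \<subseteq> [verts H]\<^bsup>r\<^esup>"

definition complete_hypergraph :: "nat \<Rightarrow> nat \<Rightarrow> nat hypergraph" where
  "complete_hypergraph r n = ({..<n}, [{..<n}]\<^bsup>r\<^esup>)"

definition complete_graph :: "nat \<Rightarrow> nat hypergraph" where
  "complete_graph t = complete_hypergraph 2 t"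

definition subhypergraph :: "'a hypergraph \<Rightarrow> 'a hypergraph \<Rightarrow> bool" where
  "subhypergraph H' H \<longleftrightarrow>
     verts H' \<subseteq> verts H \<and> edges H' \<subseteq> edges H \<and> (\<forall>e\<in>edges H'. e \<subseteq> verts H')"

definition hypergraph_iso :: "'a hypergraph \<Rightarrow> 'b hypergraph \<Rightarrow> bool" where
  "hypergraph_iso H H' \<longleftrightarrow>
     (\<exists>h. bij_betw h (verts H) (verts H') \<and> (\<lambda>e. h ` e) ` edges H = edges H')"

definition Berge :: "nat \<Rightarrow> 'a hypergraph \<Rightarrow> 'b hypergraph set" where
  "Berge r G = {H'. uniform r H' \<and>
     (\<exists>\<phi> \<psi>. inj_on \<phi> (verts G) \<and> \<phi> ` verts G \<subseteq> verts H' \<and>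
        bij_betw \<psi> (edges G) (edges H') \<and>
        (\<forall>u v. {u, v} \<in> edges G \<longrightarrow> {\<phi> u, \<phi> v} \<subseteq> \<psi> {u, v}))}"

(* The family F lives on vertex type nat; up to isomorphism this covers all
   finite hypergraphs, which are the only ones occurring inside a finite
   complete hypergraph. *)
definition ramsey_property :: "nat \<Rightarrow> nat \<Rightarrow> nat hypergraph set \<Rightarrow> nat \<Rightarrow> bool" where
  "ramsey_property r c F N \<longleftrightarrow>
     (\<forall>f \<in> edges (complete_hypergraph r N) \<rightarrow> {..<c}.
        \<exists>H'. subhypergraph H' (complete_hypergraph r N) \<and>
          (\<exists>i<c. \<forall>e\<in>edges H'. f e = i) \<and>
          (\<exists>B\<in>F. hypergraph_iso H' B))"

definition ramsey_number :: "nat \<Rightarrow> nat \<Rightarrow> nat hypergraph set \<Rightarrow> nat" where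
  "ramsey_number r c F = (LEAST N. ramsey_property r c F N)"

end

theory Submission
  imports Defs
begin

text \<open>
  Identify the vertices with the points \<open>(a, b)\<close> of an \<open>m \<times> m\<close> grid and consider the
  partitions of the grid by the lines \<open>a + i b = const\<close>, for the slopes \<open>i \<le> r choose 2\<close>.
  Two distinct points share a line for at most one slope, so for every \<open>r\<close>-set some slope
  separates all its points; this slope is its colour. The core vertices of a monochromatic
  Berge-\<open>K\<^sub>t\<close> then lie on pairwise distinct lines of one slope, of which there are fewer than
  \<open>t\<close> if \<open>m\<close> is a small constant times \<open>t\<close>. Hence the Ramsey number exceeds \<open>m\<^sup>2\<close>, which is
  of order \<open>t\<^sup>2\<close>, whereas the claimed exponent is at most \<open>3/2\<close>.
\<close>

section \<open>Lower bounds on the Ramsey number\<close>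

lemma ramsey_property_mono:
  assumes "ramsey_property r c F N" "N \<le> M"
  shows "ramsey_property r c F M"
  unfolding ramsey_property_def
proof
  fix f assume f: "f \<in> edges (complete_hypergraph r M) \<rightarrow> {..<c}"
  have sub: "verts (complete_hypergraph r N) \<subseteq> verts (complete_hypergraph r M)"
    "edges (complete_hypergraph r N) \<subseteq> edges (complete_hypergraph r M)"
    using assms(2) by (auto simp: complete_hypergraph_def nsets_def)
  then have "f \<in> edges (complete_hypergraph r N) \<rightarrow> {..<c}"
    using f by blast
  then obtain H' where "subhypergraph H' (complete_hypergraph r N)"
      "\<exists>i<c. \<forall>e\<in>edges H'. f e = i" "\<exists>B\<in>F. hypergraph_iso H' B"
    using assms(1) unfolding ramsey_property_def by blast
  moreover from this(1) have "subhypergraph H' (complete_hypergraph r M)"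
    using sub unfolding subhypergraph_def by blast
  ultimately show "\<exists>H'. subhypergraph H' (complete_hypergraph r M) \<and>
      (\<exists>i<c. \<forall>e\<in>edges H'. f e = i) \<and> (\<exists>B\<in>F. hypergraph_iso H' B)"
    by blast
qed

text \<open>\<open>LEAST\<close> yields a number with the property only if there is one; the witness
  \<open>M\<close> guarantees this. Monotonicity then rules out a least number up to
  \<open>N\<close>.\<close>

lemma less_ramsey_number:
  assumes "\<not> ramsey_property r c F N" "ramsey_property r c F M"
  shows "N < ramsey_number r c F"
proof (rule ccontr)
  assume "\<not> N < ramsey_number r c F"
  moreover have "ramsey_property r c F (ramsey_number r c F)"
    unfolding ramsey_number_def using assms(2) by (rule LeastI)
  ultimately show False
    using ramsey_property_mono assms(1) by (metis not_less)
qed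

section \<open>Existence of the Ramsey number\<close>

text \<open>Each edge of \<open>K_t\<close> is enlarged by \<open>r - 2\<close> new vertices. One
  finite member of the family is enough to derive the existence of the Ramsey number from Ramsey's
  theorem.\<close>

lemma Berge_complete_graph_exists:
  assumes "r \<ge> 2"
  obtains M E where "({..<M::nat}, E) \<in> Berge r (complete_graph t)"
proof -
  \<comment> \<open>An edge \<open>{u, v}\<close> with \<open>u < v\<close> is read as the two-digit
    number \<open>u * t + v\<close> in base \<open>t\<close>. Its new vertices start at
    \<open>t + code e * r\<close>, and \<open>M\<close> leaves room for all \<open>t * t\<close>
    blocks of length \<open>r\<close>.\<close>
  define code where "code e = Min e * t + Max e" for e :: "nat set"
  define tail where "tail k = (\<lambda>j. t + k * r + j) ` {..<r - 2}" for k :: nat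
  define \<psi> where "\<psi> e = e \<union> tail (code e)" for e
  define M where "M = t + t * t * r"
  have edge: "\<exists>u v. u < v \<and> v < t \<and> e = {u, v} \<and> code e = u * t + v"
    if et: "e \<in> [{..<t}]\<^bsup>2\<^esup>" for e
  proof -
    obtain u v where "u < v" "v < t" "e = {u, v}"
      using et unfolding ordered_nsets_2_eq by auto
    moreover from this have "Min e = u" "Max e = v" by auto
    ultimately show ?thesis by (auto simp: code_def)
  qed
  have "\<psi> e \<in> [{..<M}]\<^bsup>r\<^esup>" if "e \<in> [{..<t}]\<^bsup>2\<^esup>" for e
  proof -
    from edge[OF that] obtain u v where uv: "u < v" "v < t" "e = {u, v}" "code e = u * t + v"
      by blast
    have "u * t + v < Suc u * t" using uv by simp
    also have "\<dots> \<le> t * t" using uv by (intro mult_right_mono) auto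
    finally have "Suc (code e) \<le> t * t" using uv by simp
    then have "Suc (code e) * r \<le> t * t * r" by (rule mult_right_mono) simp
    then have "tail (code e) \<subseteq> {..<M}" by (auto simp: tail_def M_def)
    moreover have "e \<subseteq> {..<M}" using uv by (auto simp: M_def)
    moreover have "card (\<psi> e) = r"
    proof -
      have "e \<inter> tail (code e) = {}" using uv by (auto simp: tail_def)
      moreover have "card (tail (code e)) = r - 2"
        unfolding tail_def by (subst card_image) (auto simp: inj_on_def)
      ultimately show ?thesis unfolding \<psi>_def
        using uv assms by (subst card_Un_disjoint) (auto simp: tail_def)
    qed
    ultimately show ?thesis
      by (auto simp: nsets_def \<psi>_def finite_subset[OF _ finite_lessThan])
  qed
  then have "uniform r ({..<M}, \<psi> ` [{..<t}]\<^bsup>2\<^esup>)"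
    by (auto simp: uniform_def)
  moreover have "inj_on \<psi> ([{..<t}]\<^bsup>2\<^esup>)"
  proof (rule inj_on_inverseI)
    fix e :: "nat set" assume "e \<in> [{..<t}]\<^bsup>2\<^esup>"
    then show "\<psi> e \<inter> {..<t} = e" by (auto simp: \<psi>_def tail_def nsets_def)
  qed
  ultimately have "({..<M}, \<psi> ` [{..<t}]\<^bsup>2\<^esup>) \<in> Berge r (complete_graph t)"
    unfolding Berge_def complete_graph_def complete_hypergraph_def
    by (auto simp: M_def \<psi>_def bij_betw_def intro!: exI[of _ id] exI[of _ \<psi>])
  then show thesis by (rule that)
qed

text \<open>Ramsey's theorem gives a monochromatic complete \<open>r\<close>-uniform hypergraph on
  \<open>M\<close> vertices, and this contains a copy of every \<open>r\<close>-uniform hypergraph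
  on \<open>M\<close> vertices, in particular of the Berge hypergraph just built.\<close>

lemma ramsey_property_exists:
  assumes "r \<ge> 2"
  shows "\<exists>N. ramsey_property r c (Berge r (complete_graph t)) N"
proof -
  obtain M :: nat and E where ME: "({..<M}, E) \<in> Berge r (complete_graph t)"
    using Berge_complete_graph_exists[OF assms] .
  then have E: "E \<subseteq> [{..<M}]\<^bsup>r\<^esup>" by (simp add: Berge_def uniform_def)
  obtain N :: nat where N: "partn_lst {..<N} (replicate c M) r"
    using ramsey_full by blast
  have "ramsey_property r c (Berge r (complete_graph t)) N"
    unfolding ramsey_property_def
  proof
    fix f assume "f \<in> edges (complete_hypergraph r N) \<rightarrow> {..<c}"
    then have "f \<in> [{..<N}]\<^bsup>r\<^esup> \<rightarrow> {..<length (replicate c M)}"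
      by (simp add: complete_hypergraph_def)
    then obtain i H where i: "i < c" and H: "H \<in> [{..<N}]\<^bsup>M\<^esup>" and fH: "f ` [H]\<^bsup>r\<^esup> \<subseteq> {i}"
      using N unfolding partn_lst_def monochromatic_def by fastforce
    then have "finite H" "card H = M" "H \<subseteq> {..<N}" by (auto simp: nsets_def)
    then obtain h where h: "bij_betw h {..<M} H"
      by (metis ex_bij_betw_nat_finite atLeast0LessThan)
    define E' where "E' = (`) h ` E"
    have E'H: "E' \<subseteq> [H]\<^bsup>r\<^esup>"
    proof
      fix e' assume "e' \<in> E'"
      then obtain e where e: "e \<in> E" "e' = h ` e" by (auto simp: E'_def)
      then have "e \<subseteq> {..<M}" "finite e" "card e = r" using E by (auto simp: nsets_def)
      moreover have "inj_on h e"
        using h \<open>e \<subseteq> {..<M}\<close> by (meson bij_betw_def inj_on_subset)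
      ultimately show "e' \<in> [H]\<^bsup>r\<^esup>"
        using h e by (auto simp: nsets_def card_image bij_betw_def)
    qed
    define g where "g = inv_into {..<M} h"
    have "bij_betw g H {..<M}" unfolding g_def using h by (rule bij_betw_inv_into)
    moreover have "g ` h ` e = e" if "e \<in> E" for e
    proof -
      have "e \<subseteq> {..<M}" using E that by (auto simp: nsets_def)
      then show ?thesis unfolding g_def using h
        by (simp add: bij_betw_def inv_into_image_cancel)
    qed
    then have "(`) g ` E' = E" unfolding E'_def by (auto simp: image_image image_iff)
    ultimately have "hypergraph_iso (H, E') ({..<M}, E)"
      unfolding hypergraph_iso_def by auto
    moreover have "subhypergraph (H, E') (complete_hypergraph r N)"
      using E'H \<open>H \<subseteq> {..<N}\<close>
      by (auto simp: subhypergraph_def complete_hypergraph_def nsets_def)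
    moreover have "\<forall>e\<in>edges (H, E'). f e = i" using E'H fH by auto
    ultimately show "\<exists>H'. subhypergraph H' (complete_hypergraph r N) \<and>
        (\<exists>i<c. \<forall>e\<in>edges H'. f e = i) \<and>
        (\<exists>B\<in>(Berge r (complete_graph t) :: nat hypergraph set). hypergraph_iso H' B)"
      using ME i by blast
  qed
  then show ?thesis by blast
qed

section \<open>The colouring by separating slopes\<close>

text \<open>Colour each \<open>r\<close>-set by some \<open>i\<close> for which \<open>p i\<close>
  is injective on it. In a monochromatic Berge copy any two core vertices share an edge, so
  \<open>p i\<close> separates them, and the \<open>t\<close> core vertices need \<open>t\<close>
  labels where only \<open>s\<close> are available.\<close>

lemma not_ramsey_property_if_separating:
  fixes p :: "nat \<Rightarrow> nat \<Rightarrow> nat"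
  assumes bound: "\<And>i v. i < c \<Longrightarrow> v < N \<Longrightarrow> p i v < s" and "s < t"
    and sep: "\<And>e. e \<in> [{..<N}]\<^bsup>r\<^esup> \<Longrightarrow> \<exists>i<c. inj_on (p i) e"
  shows "\<not> ramsey_property r c (Berge r (complete_graph t)) N"
proof
  assume ram: "ramsey_property r c (Berge r (complete_graph t)) N"
  from sep obtain f where f: "\<And>e. e \<in> [{..<N}]\<^bsup>r\<^esup> \<Longrightarrow> f e < c \<and> inj_on (p (f e)) e"
    by metis
  then have "f \<in> edges (complete_hypergraph r N) \<rightarrow> {..<c}"
    by (auto simp: complete_hypergraph_def)
  then obtain H' i and B :: "nat hypergraph" where sub: "subhypergraph H' (complete_hypergraph r N)"
    and i: "i < c" "\<forall>e\<in>edges H'. f e = i"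
    and B: "B \<in> Berge r (complete_graph t)" "hypergraph_iso H' B"
    using ram unfolding ramsey_property_def by blast
  obtain h where h: "bij_betw h (verts H') (verts B)" "(`) h ` edges H' = edges B"
    using B(2) by (auto simp: hypergraph_iso_def)
  obtain \<phi> \<psi> where \<phi>: "inj_on \<phi> {..<t}" "\<phi> ` {..<t} \<subseteq> verts B"
    and \<psi>: "bij_betw \<psi> ([{..<t}]\<^bsup>2\<^esup>) (edges B)"
    and cover: "\<And>u v. {u, v} \<in> [{..<t}]\<^bsup>2\<^esup> \<Longrightarrow> {\<phi> u, \<phi> v} \<subseteq> \<psi> {u, v}"
    using B(1) by (auto simp: Berge_def complete_graph_def complete_hypergraph_def)
  \<comment> \<open>The core vertices lie in \<open>B\<close>, while the labels \<open>p i\<close>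
    belong to vertices of \<open>H'\<close>; \<open>g\<close> carries the core back.\<close>
  define g where "g = inv_into (verts H') h"
  have g: "g (h x) = x" if "x \<in> verts H'" for x
    using h(1) that by (simp add: g_def bij_betw_def)
  have g_inj: "inj_on g (verts B)" and g_verts: "g ` verts B = verts H'"
    using bij_betw_inv_into[OF h(1)] by (auto simp: g_def bij_betw_def)
  have "inj_on (\<lambda>u. p i (g (\<phi> u))) {..<t}"
  proof (rule inj_onI, rule ccontr)
    fix u v assume uv: "u \<in> {..<t}" "v \<in> {..<t}" "u \<noteq> v"
      and eq: "p i (g (\<phi> u)) = p i (g (\<phi> v))"
    then have pair: "{u, v} \<in> [{..<t}]\<^bsup>2\<^esup>" by (auto simp: nsets_def)
    then have "\<psi> {u, v} \<in> edges B" using \<psi> by (auto simp: bij_betw_def)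
    then obtain e where e: "e \<in> edges H'" "\<psi> {u, v} = h ` e" using h(2) by blast
    have eN: "e \<in> [{..<N}]\<^bsup>r\<^esup>" and eH: "e \<subseteq> verts H'"
      using sub e(1) by (auto simp: subhypergraph_def complete_hypergraph_def)
    have "g ` \<psi> {u, v} = e" using g eH e(2) by (force simp: image_image)
    then have "g (\<phi> u) \<in> e" "g (\<phi> v) \<in> e" using cover[OF pair] by auto
    moreover have "inj_on (p i) e" using f[OF eN] i(2) e(1) by auto
    ultimately have "g (\<phi> u) = g (\<phi> v)" using eq by (auto dest: inj_onD)
    then have "\<phi> u = \<phi> v" using g_inj \<phi>(2) uv by (auto dest: inj_onD)
    then show False using \<phi>(1) uv by (auto dest: inj_onD)
  qed
  moreover have "(\<lambda>u. p i (g (\<phi> u))) ` {..<t} \<subseteq> {..<s}"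
  proof -
    have "g (\<phi> u) < N" if "u < t" for u
      using that \<phi>(2) g_verts sub by (auto simp: subhypergraph_def complete_hypergraph_def)
    then show ?thesis using bound i(1) by auto
  qed
  ultimately have "t \<le> s" using card_inj_on_le[of _ "{..<t}" "{..<s}"] by simp
  then show False using \<open>s < t\<close> by simp
qed

text \<open>Each of the \<open>r choose 2\<close> pairs in \<open>e\<close> spoils at most one
  slope, and there is one slope more than there are pairs.\<close>

lemma exists_separating_slope:
  fixes e :: "nat set"
  assumes "finite e" "card e = r"
  shows "\<exists>i\<le>r choose 2. inj_on (\<lambda>v. v mod m + i * (v div m)) e"
proof (rule ccontr)
  assume no: "\<not> ?thesis"
  define line where "line i v = v mod m + i * (v div m)" for i v
  define bad where "bad S = {i. \<not> inj_on (line i) S}" for S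
  have bad: "finite (bad S) \<and> card (bad S) \<le> 1" if Se: "S \<in> [e]\<^bsup>2\<^esup>" for S
  proof -
    obtain u v where S: "S = {u, v}" "u \<noteq> v"
      using nsets2_E[OF Se] by metis
    have "i = j" if "i \<in> bad S" "j \<in> bad S" for i j
    proof -
      have eq: "line i u = line i v" "line j u = line j v"
        using that S by (auto simp: bad_def)
      \<comment> \<open>This is the difference of the two line equations. Its second factor is
        nonzero: if the quotients agreed, \<open>eq(1)\<close> would make the remainders agree too,
        so that \<open>u = v\<close>.\<close>
      then have "(int i - int j) * (int (u div m) - int (v div m)) = 0"
        unfolding line_def by (simp add: algebra_simps flip: of_nat_mult of_nat_add)
      moreover have "u div m \<noteq> v div m"
        using eq(1) S(2) unfolding line_def by (metis add_right_cancel div_mult_mod_eq)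
      ultimately show ?thesis by simp
    qed
    then have "bad S = {} \<or> (\<exists>i. bad S = {i})" by blast
    then show ?thesis by auto
  qed
  have "{..r choose 2} \<subseteq> (\<Union>S\<in>[e]\<^bsup>2\<^esup>. bad S)"
  proof
    fix i assume "i \<in> {..r choose 2}"
    then have "\<not> inj_on (line i) e" using no by (simp add: line_def[abs_def])
    then obtain u v where uv: "u \<in> e" "v \<in> e" "u \<noteq> v" "line i u = line i v"
      by (auto simp: inj_on_def)
    then have "{u, v} \<in> [e]\<^bsup>2\<^esup>" "i \<in> bad {u, v}" by (auto simp: nsets_def bad_def)
    then show "i \<in> (\<Union>S\<in>[e]\<^bsup>2\<^esup>. bad S)" by blast
  qed
  moreover have fin: "finite ([e]\<^bsup>2\<^esup>)" using assms(1) by (simp add: finite_imp_finite_nsets)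
  ultimately have "card {..r choose 2} \<le> card (\<Union>S\<in>[e]\<^bsup>2\<^esup>. bad S)"
    using bad by (intro card_mono) auto
  also have "\<dots> \<le> (\<Sum>S\<in>[e]\<^bsup>2\<^esup>. card (bad S))" using fin by (rule card_UN_le)
  also have "\<dots> \<le> (\<Sum>S\<in>[e]\<^bsup>2\<^esup>. 1)" using bad by (intro sum_mono) auto
  also have "\<dots> = r choose 2" using assms by simp
  finally show False by simp
qed

lemma square_less_ramsey_number_Berge:
  assumes "r \<ge> 2" "c > r choose 2" "Suc (r choose 2) * m < t"
  shows "m * m < ramsey_number r c (Berge r (complete_graph t))"
proof -
  define K where "K = r choose 2"
  \<comment> \<open>Colours beyond \<open>K\<close> repeat the slope \<open>K\<close>, so the bound
    \<open>Suc K * m\<close> on the labels holds for every colour.\<close>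
  define p where "p i v = v mod m + min i K * (v div m)" for i v
  have "\<not> ramsey_property r c (Berge r (complete_graph t)) (m * m)"
  proof (rule not_ramsey_property_if_separating)
    fix i v :: nat assume "v < m * m"
    then have m: "m > 0" by (cases m) auto
    have "v div m < m" using \<open>v < m * m\<close> by (simp add: less_mult_imp_div_less)
    then have "min i K * (v div m) \<le> K * m" by (intro mult_mono) auto
    moreover have "v mod m < m" using m by simp
    ultimately show "p i v < Suc K * m" by (simp add: p_def)
  next
    show "Suc K * m < t" using assms(3) by (simp add: K_def)
  next
    fix e assume "e \<in> [{..<m * m}]\<^bsup>r\<^esup>"
    then obtain i where "i \<le> K" "inj_on (\<lambda>v. v mod m + i * (v div m)) e"
      using exists_separating_slope[of e r m] by (auto simp: nsets_def K_def)
    then show "\<exists>i<c. inj_on (p i) e"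
      using assms(2) by (intro exI[of _ i]) (simp add: p_def[abs_def] K_def min_absorb1)
  qed
  moreover obtain N where "ramsey_property r c (Berge r (complete_graph t)) N"
    using ramsey_property_exists[OF assms(1)] by blast
  ultimately show ?thesis by (rule less_ramsey_number)
qed

section \<open>Comparison of the exponents\<close>

text \<open>With \<open>x = (r - 3) / (r - 2)\<close> the exponent is
  \<open>1 + x ^ (r - 3) * (1 - x)\<close>, and \<open>r \<ge> 4\<close> means
  \<open>x \<ge> 1 / 2\<close>.\<close>

lemma exponent_le:
  assumes "r \<ge> 4"
  shows "1 + ((real r - 3) / (real r - 2)) ^ (r - 3) - ((real r - 3) / (real r - 2)) ^ (r - 2)
    \<le> 3 / 2"
proof -
  define x where "x = (real r - 3) / (real r - 2)"
  have x: "1 / 2 \<le> x" "x \<le> 1" using assms by (auto simp: x_def field_simps)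
  have "r - 2 = Suc (r - 3)" using assms by simp
  then have "x ^ (r - 3) - x ^ (r - 2) = x ^ (r - 3) * (1 - x)"
    by (simp add: algebra_simps)
  also have "\<dots> \<le> 1 * (1 / 2)" using x by (intro mult_mono power_le_one) auto
  finally show ?thesis by (simp add: x_def)
qed

text \<open>Here \<open>m\<close> is the largest number with \<open>k * m < t\<close>. It satisfies
  \<open>t \<le> 2 * m * k\<close>, so \<open>m * m\<close> is at least
  \<open>t ^ 2 / (4 * k ^ 2)\<close>. The threshold on \<open>t\<close> says
  \<open>4 * k ^ 2 \<le> sqrt t\<close>, which leaves at least
  \<open>t powr (3 / 2)\<close>.\<close>

lemma powr_three_halves_le_square:
  fixes k t :: nat
  assumes k: "k > 0" and t: "t \<ge> 16 * k ^ 4"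
  defines "m \<equiv> (t - 1) div k"
  shows "real t powr (3 / 2) \<le> real (m * m)"
proof -
  have "k ^ 1 \<le> k ^ 4" using k by (intro power_increasing) auto
  then have "t \<ge> 16 * k" using t by simp
  moreover have "t - 1 < m * k + k"
    unfolding m_def using k by (metis add.commute dividend_less_times_div mult.commute)
  ultimately have "t \<le> 2 * (m * k)" using k by linarith
  then have "real t \<le> real (2 * (m * k))" by (simp only: of_nat_le_iff)
  then have "real t ^ 2 \<le> (real (2 * (m * k))) ^ 2" by (rule power_mono) simp
  then have t2: "real t ^ 2 \<le> 4 * real k ^ 2 * real (m * m)"
    by (simp add: power2_eq_square algebra_simps)
  have "(4 * real k ^ 2) ^ 2 \<le> real t"
    using t by (simp add: power_mult_distrib flip: power_mult of_nat_le_iff[where 'a = real])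
  then have sq: "4 * real k ^ 2 \<le> sqrt (real t)" by (rule real_le_rsqrt)
  have t0: "real t > 0" using \<open>t \<ge> 16 * k\<close> k by simp
  have "real t powr (3 / 2) * sqrt (real t) = real t ^ 2"
    using t0 by (simp add: powr_half_sqrt[symmetric] powr_add[symmetric])
  then have "4 * real k ^ 2 * real t powr (3 / 2) \<le> real t ^ 2"
    using mult_right_mono[OF sq, of "real t powr (3 / 2)"] by (simp add: mult.commute)
  also note t2
  finally show ?thesis using k by simp
qed

theorem theorem2p17:
  fixes r :: nat
  assumes "r \<ge> 4"
  shows "\<exists>c0 t0 :: nat. \<forall>c\<ge>c0. \<forall>t\<ge>t0.
    real (ramsey_number r c (Berge r (complete_graph t))) >
      real t powr (1 + ((real r - 3) / (real r - 2)) ^ (r - 3)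
                     - ((real r - 3) / (real r - 2)) ^ (r - 2))"
proof (intro exI allI impI)
  define k where "k = Suc (r choose 2)"
  \<comment> \<open>These assumptions fix the witnesses: \<open>c0 = k\<close>, one colour per
    slope, and \<open>t0 = 16 * k ^ 4\<close>, the threshold of
    \<open>powr_three_halves_le_square\<close>.\<close>
  fix c t assume c: "c \<ge> k" and t: "t \<ge> 16 * k ^ 4"
  define m where "m = (t - 1) div k"
  have "k > 0" by (simp add: k_def)
  then have "k ^ 4 > 0" by simp
  then have t1: "t \<ge> 1" using t by linarith
  have "k * m \<le> t - 1" by (simp add: m_def)
  then have "k * m < t" using t1 by linarith
  have "real t powr (1 + ((real r - 3) / (real r - 2)) ^ (r - 3)
      - ((real r - 3) / (real r - 2)) ^ (r - 2)) \<le> real t powr (3 / 2)"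
    using exponent_le[OF assms] t1 by (intro powr_mono) auto
  also have "\<dots> \<le> real (m * m)"
    unfolding m_def using \<open>k > 0\<close> t by (rule powr_three_halves_le_square)
  also have "\<dots> < real (ramsey_number r c (Berge r (complete_graph t)))"
    using square_less_ramsey_number_Berge[of r c m t] assms c \<open>k * m < t\<close>
    unfolding k_def by (simp only: of_nat_less_iff)
  finally show "real t powr (1 + ((real r - 3) / (real r - 2)) ^ (r - 3)
      - ((real r - 3) / (real r - 2)) ^ (r - 2))
    < real (ramsey_number r c (Berge r (complete_graph t)))" .
qed

end
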